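(* If $(a_k)_{k\ge0}$ is a log-concave sequence, then the sequence $(c_k)_{k\ge0}$ defined by $$c_k=\sum_{n=k}^\infty\binom{n}{k}a_n\qquad(k\ge0)$$ is log-concave as well.
   Context: A sequence $(a_n)_{n\ge 0}$ of real numbers is log-concave if all its terms are non-negative and $a_{\lambda n + (1-\lambda) m} \ge a_n^\lambda a_m^{1-\lambda}$ for all integers $m,n\ge 0$ and all $\lambda\in(0,1)$ such that $\lambda n+(1-\lambda)m$ is an integer. Equivalently: the terms are non-negative, $a_n^2 \ge a_{n-1}a_{n+1}$ for all $n\ge1$, and $\{n\ge 0 : a_n>0\}$ is a (finite or infinite, possibly empty) interval of integers. The series defining $c_k$ have non-negative terms and are summed in $[0,+\infty]$; if some values are infinite, log-concavity of $(c_k)$ is understood as the same inequalities in $[0,+\infty]$. *)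

theory Defs
  imports "HOL-Analysis.Analysis"
begin

definition log_concave_seq :: "(nat \<Rightarrow> real) \<Rightarrow> bool" where
  "log_concave_seq a \<longleftrightarrow>
     (\<forall>n. 0 \<le> a n) \<and>
     (\<forall>m n k. \<forall>t\<in>{0<..<1::real}.
        real k = t * real n + (1 - t) * real m \<longrightarrow>
        a k \<ge> a n powr t * a m powr (1 - t))"

(* Meant for positive exponents only, whence the value top at top. *)
definition ennreal_powr :: "ennreal \<Rightarrow> real \<Rightarrow> ennreal" where
  "ennreal_powr x p = (if x = top then top else ennreal (enn2real x powr p))"

(* The product is that of ennreal, so 0 * top = 0. *)
definition ennreal_log_concave_seq :: "(nat \<Rightarrow> ennreal) \<Rightarrow> bool" where
  "ennreal_log_concave_seq c \<longleftrightarrow>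
     (\<forall>m n k. \<forall>t\<in>{0<..<1::real}.
        real k = t * real n + (1 - t) * real m \<longrightarrow>
        c k \<ge> ennreal_powr (c n) t * ennreal_powr (c m) (1 - t))"

lemma log_concave_seq_iff_ennreal:
  "log_concave_seq a \<longleftrightarrow>
     (\<forall>n. 0 \<le> a n) \<and> ennreal_log_concave_seq (\<lambda>n. ennreal (a n))"
proof (cases "\<forall>n. 0 \<le> a n")
  case True
  then have "ennreal_powr (ennreal (a n)) p * ennreal_powr (ennreal (a m)) q \<le> ennreal (a k)
      \<longleftrightarrow> a n powr p * a m powr q \<le> a k" for n m k p q
    by (simp add: ennreal_powr_def flip: ennreal_mult)
  with True show ?thesis
    by (simp add: log_concave_seq_def ennreal_log_concave_seq_def)
qed (auto simp: log_concave_seq_def)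

corollary ennreal_log_concave_seq_finite_iff:
  assumes "\<And>n. c n \<noteq> top"
  shows "ennreal_log_concave_seq c \<longleftrightarrow> log_concave_seq (\<lambda>n. enn2real (c n))"
  using assms by (simp add: log_concave_seq_iff_ennreal less_top)

definition binomial_tail_sum :: "(nat \<Rightarrow> real) \<Rightarrow> nat \<Rightarrow> ennreal" where
  "binomial_tail_sum a k = (\<Sum>\<^sub>\<infinity>n\<in>{k..}. ennreal (real (n choose k) * a n))"

end

theory Submission
  imports Defs
begin

text \<open>
  Let \<open>T\<close> be the operator that sends a sequence \<open>b\<close> to its tail sums
  \<open>i \<mapsto> b i + b (i + 1) + \<dots>\<close>. By the hockey-stick identity, iterating \<open>T\<close> produces
  binomial weights, and reading off the diagonal gives
  \<open>c\<^sub>k = (T ^^ (k + 1)) a k\<close>. This turns the inequality between three neighbouring terms of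
  \<open>c\<close> into one between \<open>b\<close>, \<open>T b\<close> and \<open>T (T b)\<close>, where \<open>b = (T ^^ (k + 1)) a\<close>:
  \<open>b k * T (T b) (k + 2) \<le> (T b (k + 1))\<^sup>2\<close>. Both sides are double series, indexed by
  \<open>m\<close> and \<open>n\<close>, and the inequality already holds term by term, since
  \<open>b k * b (k + 2 + m + n) \<le> b (k + 1 + m) * b (k + 1 + n)\<close> as soon as \<open>b\<close> is log-concave
  (\<open>tail_sum_twice\<close>). And \<open>b\<close> is log-concave because \<open>T\<close> preserves log-concavity
  (\<open>cross_log_concave_tail_sum\<close>).

  These steps compare sums and products of non-negative series and never subtract or divide
  them, so they take place in \<open>[0, \<infinity>]\<close> without a case distinction on convergence.
  Infinite values matter only in the last part, where the neighbour inequality, together with the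
  fact that the positive terms of \<open>c\<close> form an initial segment, is converted into the weighted
  inequality (\<open>ennreal_log_concave_seqI\<close>).
\<close>

section \<open>Log-concavity and tail sums\<close>

definition tail_sum :: "(nat \<Rightarrow> ennreal) \<Rightarrow> nat \<Rightarrow> ennreal" where
  "tail_sum b i = (\<Sum>n. b (i + n))"

text \<open>
  The exchange form of log-concavity, with products instead of real powers, so that
  it makes sense in \<open>[0, \<infinity>]\<close> and can be summed over the indices.
\<close>
definition cross_log_concave :: "(nat \<Rightarrow> ennreal) \<Rightarrow> bool" where
  "cross_log_concave b \<longleftrightarrow> (\<forall>i s t. b i * b (i + s + t) \<le> b (i + s) * b (i + t))"

lemma cross_log_concaveD:
  assumes "cross_log_concave b" "i \<le> p" "i \<le> q" "p + q = i + l"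
  shows "b i * b l \<le> b p * b q"
proof -
  from assms have "l = i + (p - i) + (q - i)" "p = i + (p - i)" "q = i + (q - i)"
    by auto
  with assms(1) show ?thesis
    unfolding cross_log_concave_def by metis
qed

text \<open>
  Between \<open>i\<close> and \<open>l = i + s + t\<close> the points \<open>i + s\<close> and \<open>i + t\<close> are convex combinations
  with exchanged weights \<open>p\<close> and \<open>q\<close>. Multiplying the two weighted inequalities
  therefore gives \<open>a i\<close> and \<open>a l\<close> total exponent \<open>p + q = 1\<close> each.
\<close>
lemma cross_log_concave_ennreal:
  assumes "log_concave_seq a"
  shows "cross_log_concave (\<lambda>n. ennreal (a n))"
  unfolding cross_log_concave_def
proof (intro allI)
  fix i s t :: nat
  from assms have nonneg: "0 \<le> a n" for n
    by (simp add: log_concave_seq_def)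
  show "ennreal (a i) * ennreal (a (i + s + t)) \<le> ennreal (a (i + s)) * ennreal (a (i + t))"
  proof (cases "s = 0 \<or> t = 0")
    case True
    then show ?thesis by (auto simp: mult.commute)
  next
    case False
    define l where "l = i + s + t"
    define p where "p = real t / real (s + t)"
    define q where "q = real s / real (s + t)"
    from False have pq: "p \<in> {0<..<1}" "q \<in> {0<..<1}" and sum1: "1 - p = q" "1 - q = p" "p + q = 1"
      by (auto simp: p_def q_def divide_simps)
    have comb: "real (i + s) = p * real i + (1 - p) * real l"
         "real (i + t) = q * real i + (1 - q) * real l"
    proof -
      from False have "q * real (s + t) = real s" "p * real (s + t) = real t"
        by (simp_all add: p_def q_def)
      moreover have "real l = real i + real (s + t)" by (simp add: l_def)
      ultimately show "real (i + s) = p * real i + (1 - p) * real l"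
          "real (i + t) = q * real i + (1 - q) * real l"
        unfolding sum1 using sum1 by (simp_all add: distrib_left flip: distrib_right)
    qed
    have split: "a n powr p * a n powr q = a n" for n
      using nonneg[of n] sum1 by (simp add: powr_add[symmetric])
    have step: "a k \<ge> a n powr r * a m powr (1 - r)"
      if "r \<in> {0<..<1}" "real k = r * real n + (1 - r) * real m" for k n m r
      using assms that unfolding log_concave_seq_def by blast
    have "a i * a l = (a i powr p * a i powr q) * (a l powr p * a l powr q)"
      by (simp only: split)
    also have "\<dots> = (a i powr p * a l powr q) * (a i powr q * a l powr p)"
      by (simp add: ac_simps)
    also have "\<dots> \<le> a (i + s) * a (i + t)"
      using step[OF pq(1) comb(1)] step[OF pq(2) comb(2)] nonneg
      unfolding sum1 by (intro mult_mono) auto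
    finally show ?thesis
      by (simp add: l_def nonneg flip: ennreal_mult)
  qed
qed

lemma tail_sum_split: "tail_sum b i = (\<Sum>j<s. b (i + j)) + tail_sum b (i + s)"
proof -
  have "(\<Sum>n. b (i + n)) = (\<Sum>n. b (i + (n + s))) + (\<Sum>j<s. b (i + j))"
    by (rule suminf_offset) simp
  then show ?thesis
    by (simp add: tail_sum_def ac_simps)
qed

text \<open>
  Splitting off \<open>s\<close> terms of the series \<open>T b i\<close> and \<open>T b (i + t)\<close> leaves the same product
  \<open>T b (i + s) * T b (i + s + t)\<close> on both sides of the exchange inequality. What remains
  is a finite sum of series that compare term by term by the exchange inequality for \<open>b\<close>.
\<close>
lemma cross_log_concave_tail_sum:
  assumes "cross_log_concave b"
  shows "cross_log_concave (tail_sum b)"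
  unfolding cross_log_concave_def
proof (intro allI)
  fix i s t :: nat
  let ?T = "tail_sum b"
  have "b (i + j) * ?T (i + s + t) \<le> ?T (i + s) * b (i + t + j)" if "j < s" for j
  proof -
    have "b (i + j) * ?T (i + s + t) = (\<Sum>n. b (i + j) * b (i + s + t + n))"
      by (simp add: tail_sum_def)
    also have "\<dots> \<le> (\<Sum>n. b (i + s + n) * b (i + t + j))"
      using that by (intro suminf_le cross_log_concaveD[OF assms]) simp_all
    also have "\<dots> = ?T (i + s) * b (i + t + j)"
      by (simp add: tail_sum_def)
    finally show ?thesis .
  qed
  then have "(\<Sum>j<s. b (i + j)) * ?T (i + s + t) \<le> ?T (i + s) * (\<Sum>j<s. b (i + t + j))"
    unfolding sum_distrib_left sum_distrib_right by (intro sum_mono) simp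
  then have "?T i * ?T (i + s + t) \<le>
      ?T (i + s) * (\<Sum>j<s. b (i + t + j)) + ?T (i + s) * ?T (i + s + t)"
    by (subst tail_sum_split[of b i s]) (simp add: distrib_right add_right_mono)
  also have "\<dots> = ?T (i + s) * ?T (i + t)"
    using tail_sum_split[of b "i + t" s] by (simp add: distrib_left ac_simps)
  finally show "?T i * ?T (i + s + t) \<le> ?T (i + s) * ?T (i + t)" .
qed

text \<open>
  This is the neighbour inequality for the binomial sums in disguise. The index moves up by one
  with every further summation, so both sides range over all pairs \<open>(m, n)\<close>.
\<close>
lemma tail_sum_twice:
  assumes "cross_log_concave b"
  shows "b k * tail_sum (tail_sum b) (k + 2) \<le> tail_sum b (k + 1) * tail_sum b (k + 1)"
proof -
  have "b k * tail_sum (tail_sum b) (k + 2) = (\<Sum>m. \<Sum>n. b k * b (k + 2 + m + n))"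
    by (simp add: tail_sum_def)
  also have "\<dots> \<le> (\<Sum>m. \<Sum>n. b (k + 1 + m) * b (k + 1 + n))"
    by (intro suminf_le cross_log_concaveD[OF assms]) simp_all
  also have "\<dots> = tail_sum b (k + 1) * tail_sum b (k + 1)"
    by (simp add: tail_sum_def)
  finally show ?thesis .
qed

section \<open>Binomial sums as iterated tail sums\<close>

lemma suminf_swap_ennreal:
  fixes f :: "nat \<Rightarrow> nat \<Rightarrow> ennreal"
  shows "(\<Sum>m. \<Sum>n. f m n) = (\<Sum>n. \<Sum>m. f m n)"
  using nn_integral_suminf[of "\<lambda>n m. f m n" "count_space UNIV"]
  by (simp add: nn_integral_count_space_nat)

text \<open>Summation of a double series along its antidiagonals.\<close>
lemma suminf_triangle_ennreal:
  fixes f :: "nat \<Rightarrow> nat \<Rightarrow> ennreal"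
  shows "(\<Sum>m. \<Sum>n. f m n) = (\<Sum>N. \<Sum>n\<le>N. f (N - n) n)"
proof -
  have shift: "(\<Sum>m. f m n) = (\<Sum>N. if n \<le> N then f (N - n) n else 0)" for n
    using suminf_offset[of "\<lambda>N. if n \<le> N then f (N - n) n else 0" n] by simp
  have column: "(\<Sum>n. if n \<le> N then f (N - n) n else 0) = (\<Sum>n\<le>N. f (N - n) n)" for N
    by (subst suminf_finite[of "{..N}"]) auto
  have "(\<Sum>m. \<Sum>n. f m n) = (\<Sum>n. \<Sum>N. if n \<le> N then f (N - n) n else 0)"
    by (subst suminf_swap_ennreal) (simp only: shift)
  also have "\<dots> = (\<Sum>N. \<Sum>n\<le>N. f (N - n) n)"
    by (subst suminf_swap_ennreal) (simp only: column)
  finally show ?thesis .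
qed

text \<open>
  The coefficient of \<open>b (i + N)\<close> in the next tail sum collects the coefficients of all
  \<open>n \<le> N\<close>; their sum is evaluated by the hockey-stick identity \<open>choose_rising_sum\<close>.
\<close>
lemma tail_sum_funpow:
  "(tail_sum ^^ Suc k) b i = (\<Sum>n. of_nat ((n + k) choose k) * b (i + n))"
proof (induction k arbitrary: i)
  case 0
  show ?case by (simp add: tail_sum_def)
next
  case (Suc k)
  have "(tail_sum ^^ Suc (Suc k)) b i = tail_sum ((tail_sum ^^ Suc k) b) i"
    by simp
  also have "\<dots> = (\<Sum>m. \<Sum>n. of_nat ((n + k) choose k) * b (i + m + n))"
    by (subst tail_sum_def) (simp only: Suc.IH)
  also have "\<dots> = (\<Sum>N. \<Sum>n\<le>N. of_nat ((n + k) choose k) * b (i + N))"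
    by (subst suminf_triangle_ennreal) (intro suminf_cong sum.cong, auto simp: add.assoc)
  also have "\<dots> = (\<Sum>N. of_nat ((N + Suc k) choose Suc k) * b (i + N))"
  proof -
    have "(\<Sum>n\<le>N. (n + k) choose k) = (N + Suc k) choose Suc k" for N
      using choose_rising_sum(1)[of k N] by (simp add: ac_simps)
    then show ?thesis
      by (simp only: sum_distrib_right[symmetric] of_nat_sum[symmetric])
  qed
  finally show ?case .
qed

lemma binomial_tail_sum_suminf:
  assumes "\<And>n. 0 \<le> a n"
  shows "binomial_tail_sum a k = (\<Sum>n. of_nat ((n + k) choose k) * ennreal (a (k + n)))"
proof -
  have "binomial_tail_sum a k
      = (\<Sum>\<^sub>\<infinity>n\<in>UNIV. ennreal (real ((n + k) choose k) * a (k + n)))"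
    unfolding binomial_tail_sum_def
    by (rule infsum_reindex_bij_witness[of _ "\<lambda>n. n + k" "\<lambda>n. n - k"]) (auto simp: ac_simps)
  also have "\<dots> = (\<Sum>n. ennreal (real ((n + k) choose k) * a (k + n)))"
    by (rule sums_unique[OF has_sum_imp_sums[OF has_sum_infsum]])
       (simp add: nonneg_summable_on_complete)
  finally show ?thesis
    using assms by (simp add: ennreal_mult ennreal_of_nat_eq_real_of_nat)
qed

text \<open>
  On the diagonal, the weight \<open>(n + k) choose k\<close> sits at the index \<open>k + n\<close>, which is
  exactly its place in the binomial sum.
\<close>
lemma binomial_tail_sum_eq_tail_sum_funpow:
  assumes "\<And>n. 0 \<le> a n"
  shows "binomial_tail_sum a k = (tail_sum ^^ Suc k) (\<lambda>n. ennreal (a n)) k"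
  by (simp only: binomial_tail_sum_suminf[OF assms] tail_sum_funpow)

lemma binomial_tail_sum_adjacent:
  assumes "log_concave_seq a"
  shows "binomial_tail_sum a k * binomial_tail_sum a (k + 2)
    \<le> binomial_tail_sum a (k + 1) * binomial_tail_sum a (k + 1)"
proof -
  from assms have nonneg: "\<And>n. 0 \<le> a n"
    by (simp add: log_concave_seq_def)
  have "cross_log_concave ((tail_sum ^^ j) (\<lambda>n. ennreal (a n)))" for j
    by (induction j) (simp_all add: cross_log_concave_ennreal[OF assms] cross_log_concave_tail_sum)
  from tail_sum_twice[OF this[of "Suc k"], of k] show ?thesis
    by (simp add: binomial_tail_sum_eq_tail_sum_funpow[OF nonneg])
qed

lemma binomial_tail_sum_pos_downward:
  assumes "\<And>n. 0 \<le> a n" "binomial_tail_sum a m > 0" "k \<le> m"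
  shows "binomial_tail_sum a k > 0"
proof (rule ccontr)
  assume "\<not> binomial_tail_sum a k > 0"
  then have "binomial_tail_sum a k = 0" by simp
  then have "(\<Sum>n. of_nat ((n + k) choose k) * ennreal (a (k + n))) = 0"
    by (simp add: binomial_tail_sum_suminf[OF assms(1)])
  then have "ennreal (a (k + n)) = 0" for n
    by (subst (asm) suminf_eq_zero_iff) (auto simp: binomial_eq_0_iff)
  then have "ennreal (a (m + n)) = 0" for n
    using assms(3) by (metis add.assoc le_Suc_ex)
  then have "binomial_tail_sum a m = 0"
    by (simp add: binomial_tail_sum_suminf[OF assms(1)])
  with assms(2) show False by simp
qed

section \<open>From neighbours to weighted means\<close>

text \<open>
  An infinite value spreads: if \<open>c i\<close> is infinite and \<open>c (i + 2)\<close> is positive, then their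
  product is infinite and \<open>c (i + 1)\<close> is forced to be infinite, and the same holds with the two
  exchanged. Starting from \<open>j\<close>, infinity thus reaches every interior point of the interval,
  in particular \<open>k\<close>. It need not reach the other endpoint, where the next term may vanish,
  so \<open>k\<close> has to lie strictly inside.
\<close>
lemma finite_of_interior_finite:
  fixes c :: "nat \<Rightarrow> ennreal"
  assumes adj: "\<And>k. c k * c (k + 2) \<le> c (k + 1) * c (k + 1)"
    and pos: "\<And>j. n \<le> j \<Longrightarrow> j \<le> m \<Longrightarrow> c j > 0"
    and k: "n < k" "k < m" "c k \<noteq> top"
    and j: "n \<le> j" "j \<le> m"
  shows "c j \<noteq> top"
proof
  assume top: "c j = top"
  have mid: "c (i + 1) = top" if "c i * c (i + 2) = top" for i
    using adj[of i] that by (auto simp: ennreal_mult_eq_top_iff top_unique)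
  have right: "c i = top" if "j \<le> i" "i < m" for i
    using that
  proof (induction i rule: dec_induct)
    case (step i)
    then show ?case 
      using pos[of "i + 2"] j mid[of i] by (auto simp: ennreal_mult_eq_top_iff)
  qed (rule top)
  have left: "c i = top" if "i \<le> j" "n < i" for i
    using that
  proof (induction i rule: inc_induct)
    case (step i)
    then show ?case
      using pos[of "i - 1"] j mid[of "i - 1"]
      by (cases i) (auto simp: ennreal_mult_eq_top_iff)
  qed (rule top)
  from left[of k] right[of k] k show False
    by (cases "j \<le> k") auto
qed

text \<open>
  The differences \<open>d\<close> are non-increasing, so \<open>d k\<close> bounds the slope of \<open>f\<close> from below
  on the left of \<open>k\<close> and from above on the right. The weights make the two bounds cancel,
  because \<open>k\<close> divides the interval in the ratio given by \<open>t (k - n) = (1 - t) (m - k)\<close>.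
\<close>
lemma concave_nat_weighted:
  fixes f :: "nat \<Rightarrow> real"
  assumes conc: "\<And>j. n \<le> j \<Longrightarrow> j + 2 \<le> m \<Longrightarrow> f j + f (j + 2) \<le> 2 * f (j + 1)"
    and k: "n < k" "k < m"
    and t: "0 < t" "t < 1" "real k = t * real n + (1 - t) * real m"
  shows "t * f n + (1 - t) * f m \<le> f k"
proof -
  define d where "d j = f (Suc j) - f j" for j
  have mono: "d j \<le> d i" if "n \<le> i" "i \<le> j" "j < m" for i j
    using that(2,3)
  proof (induction j rule: dec_induct)
    case (step j)
    with conc[of j] that(1) show ?case by (simp add: d_def)
  qed simp
  have tele: "f q - f p = (\<Sum>j=p..<q. d j)" if "p \<le> q" for p q
    unfolding d_def using sum_Suc_diff'[OF that, of f] by simp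
  have lower: "real (k - n) * d k \<le> f k - f n"
    using tele[of n k] k sum_bounded_below[of "{n..<k}" "d k" d] mono by auto
  have upper: "f m - f k \<le> real (m - k) * d k"
    using tele[of k m] k sum_bounded_above[of "{k..<m}" d "d k"] mono by auto
  have balance: "t * real (k - n) = (1 - t) * real (m - k)"
    using t(3) k by (simp add: of_nat_diff algebra_simps)
  have "(1 - t) * (f m - f k) \<le> (1 - t) * (real (m - k) * d k)"
    using t by (intro mult_left_mono upper) simp
  also have "\<dots> = t * (real (k - n) * d k)"
    using balance by (metis mult.assoc)
  also have "\<dots> \<le> t * (f k - f n)"
    using t by (intro mult_left_mono lower) simp
  finally show ?thesis by (simp add: algebra_simps)
qed

text \<open>
  The bound is trivial if an end value is zero or if \<open>c k\<close> is infinite. In the remaining case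
  every value between the ends is positive and finite, so that logarithms reduce the claim
  to concavity of a real sequence.
\<close>
lemma ennreal_log_concave_seqI:
  fixes c :: "nat \<Rightarrow> ennreal"
  assumes adj: "\<And>k. c k * c (k + 2) \<le> c (k + 1) * c (k + 1)"
    and pos: "\<And>n m k. 0 < c n \<Longrightarrow> 0 < c m \<Longrightarrow> n \<le> k \<Longrightarrow> k \<le> m \<Longrightarrow> 0 < c k"
  shows "ennreal_log_concave_seq c"
proof -
  have ordered: "ennreal_powr (c n) t * ennreal_powr (c m) (1 - t) \<le> c k"
    if t: "0 < t" "t < 1" "real k = t * real n + (1 - t) * real m" and nm: "n < m" for n m k t
  proof (cases "c n = 0 \<or> c m = 0 \<or> c k = top")
    case True
    then show ?thesis by (auto simp: ennreal_powr_def)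
  next
    case False
    have "t * real n < t * real m" "(1 - t) * real n < (1 - t) * real m"
      using t nm by simp_all
    then have "real n < real k" "real k < real m"
      using t(3) by (auto simp: algebra_simps)
    then have k: "n < k" "k < m" by simp_all
    have c_pos: "0 < c j" if "n \<le> j" "j \<le> m" for j
      using False pos[of n m j] that by (simp add: zero_less_iff_neq_zero)
    have c_fin: "c j \<noteq> top" if "n \<le> j" "j \<le> m" for j
      using finite_of_interior_finite[of c, OF adj c_pos k _ that] False by auto
    define x where "x j = enn2real (c j)" for j
    have cx: "c j = ennreal (x j)" "0 < x j" if "n \<le> j" "j \<le> m" for j
      using c_fin[OF that] c_pos[OF that]
      by (simp_all add: x_def enn2real_positive_iff less_top)
    have "t * ln (x n) + (1 - t) * ln (x m) \<le> ln (x k)"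
    proof (rule concave_nat_weighted[OF _ k t])
      fix j assume j: "n \<le> j" "j + 2 \<le> m"
      then have xs: "0 < x j" "0 < x (j + 1)" "0 < x (j + 2)"
        by (auto intro!: cx(2))
      have "ennreal (x j * x (j + 2)) \<le> ennreal (x (j + 1) * x (j + 1))"
        using adj[of j] j xs cx(1)[of j] cx(1)[of "j + 1"] cx(1)[of "j + 2"]
        by (simp add: ennreal_mult)
      then have "ln (x j * x (j + 2)) \<le> ln (x (j + 1) * x (j + 1))"
        using xs by simp
      then show "ln (x j) + ln (x (j + 2)) \<le> 2 * ln (x (j + 1))"
        using xs by (simp add: ln_mult)
    qed
    then have "exp (t * ln (x n) + (1 - t) * ln (x m)) \<le> x k"
      using cx(2)[of k] k by (metis exp_le_cancel_iff exp_ln less_imp_le)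
    then have "x n powr t * x m powr (1 - t) \<le> x k"
      using cx(2)[of n] cx(2)[of m] nm by (simp add: powr_def exp_add)
    then have "ennreal (x n powr t) * ennreal (x m powr (1 - t)) \<le> ennreal (x k)"
      by (simp add: ennreal_leI flip: ennreal_mult)
    moreover have "ennreal_powr (c j) p = ennreal (x j powr p)" if "n \<le> j" "j \<le> m" for j p
      using c_fin[OF that] by (simp add: ennreal_powr_def x_def)
    ultimately show ?thesis
      using cx(1)[of k] k by simp
  qed
  show ?thesis
    unfolding ennreal_log_concave_seq_def
  proof (intro allI ballI impI)
    fix m n k :: nat and t :: real
    assume t: "t \<in> {0<..<1}" and k: "real k = t * real n + (1 - t) * real m"
    consider "n < m" | "m < n" | "n = m" by linarith
    then show "ennreal_powr (c n) t * ennreal_powr (c m) (1 - t) \<le> c k"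
    proof cases
      case 1
      then show ?thesis using ordered[of t k n m] t k by simp
    next
      case 2
      then show ?thesis using ordered[of "1 - t" k m n] t k by (simp add: ac_simps)
    next
      case 3
      then have "k = n" using k by (simp add: algebra_simps)
      moreover have "enn2real (c n) powr t * enn2real (c n) powr (1 - t) = enn2real (c n)"
        by (simp flip: powr_add)
      ultimately show ?thesis using 3
        by (cases "c n = top") (simp_all add: ennreal_powr_def less_top flip: ennreal_mult)
    qed
  qed
qed

theorem proposition3p5:
  fixes a :: "nat \<Rightarrow> real"
  assumes "log_concave_seq a"
  shows "ennreal_log_concave_seq (binomial_tail_sum a)"
proof (rule ennreal_log_concave_seqI)
  fix n m k
  assume "0 < binomial_tail_sum a m" "k \<le> m"
  with assms show "0 < binomial_tail_sum a k"
    by (intro binomial_tail_sum_pos_downward[of a m k]) (auto simp: log_concave_seq_def)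
qed (rule binomial_tail_sum_adjacent[OF assms])

end
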